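(* Let $n\ge 2$, let $P$ and $E$ be $n\times n$ row stochastic matrices, and let $0\leq c\leq 1$. Let $A = cP+(1-c)E$, and let $\lambda_1,\ldots,\lambda_n\in\mathbb{C}$ be the eigenvalues of $A$, counted with algebraic multiplicity and ordered so that $1=\lambda_1\geq |\lambda_2|\geq |\lambda_3|\geq\cdots\geq|\lambda_n|$. Then $$|\lambda_2| \leq c\, q(P) + (1-c)\, q(E),$$ and, if $E$ has rank $1$, then $|\lambda_2|\leq c$.
   Context: A real $n\times n$ matrix $B=(b_{ij})$ is row stochastic if $b_{ij}\ge 0$ for all $i,j$ and $\sum_{j=1}^n b_{ij}=1$ for every $1\le i\le n$. For an $n\times n$ row stochastic matrix $B=(b_{ij})$, the number $q(B)$ is $$q(B) = \frac12 \sup_{i,k} \sum_{j=1}^n |b_{ij}-b_{kj}| = 1-\min_{i,k}\sum_{j=1}^n \min(b_{ij},b_{kj}),$$ where $i,k$ range over $\{1,\ldots,n\}$ (the two expressions agree for row stochastic $B$). *)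

theory Defs
  imports Complex_Main "Jordan_Normal_Form.Char_Poly" "Jordan_Normal_Form.DL_Rank"
begin

definition row_stochastic :: "nat \<Rightarrow> real mat \<Rightarrow> bool" where
  "row_stochastic n B \<longleftrightarrow> B \<in> carrier_mat n n \<and>
     (\<forall>i<n. \<forall>j<n. 0 \<le> B $$ (i, j)) \<and> (\<forall>i<n. (\<Sum>j<n. B $$ (i, j)) = 1)"

definition q :: "real mat \<Rightarrow> real" where
  "q B = (1 / 2) * (SUP (i, k) \<in> {..<dim_row B} \<times> {..<dim_row B}.
            \<Sum>j<dim_col B. \<bar>B $$ (i, j) - B $$ (k, j)\<bar>)"

text \<open>Algebraic multiplicities are encoded by the factorization of the characteristic
  polynomial over the complex numbers. Eigenvalues are numbered from 1 to n, with the values of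
  \<open>lam\<close> elsewhere irrelevant; matrix indices run from 0 to n - 1.\<close>

definition ordered_eigenvalues :: "nat \<Rightarrow> real mat \<Rightarrow> (nat \<Rightarrow> complex) \<Rightarrow> bool" where
  "ordered_eigenvalues n A lam \<longleftrightarrow>
     char_poly (map_mat complex_of_real A) = (\<Prod>k=1..n. [:- lam k, 1:]) \<and>
     lam 1 = 1 \<and>
     (\<forall>i\<in>{1..n}. \<forall>k\<in>{1..n}. i \<le> k \<longrightarrow> cmod (lam k) \<le> cmod (lam i))"

lemma q_eq_one_minus_Min:
  assumes "row_stochastic n B" and "n \<ge> 1"
  shows "q B = 1 - Min ((\<lambda>(i, k). \<Sum>j<n. min (B $$ (i, j)) (B $$ (k, j))) ` ({..<n} \<times> {..<n}))"
proof -
  let ?I = "{..<n} \<times> {..<n}"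
  let ?d = "\<lambda>(i, k). \<Sum>j<n. \<bar>B $$ (i, j) - B $$ (k, j)\<bar>"
  let ?m = "\<lambda>(i, k). \<Sum>j<n. min (B $$ (i, j)) (B $$ (k, j))"
  have dims: "dim_row B = n" "dim_col B = n"
    and sums: "\<And>i. i < n \<Longrightarrow> (\<Sum>j<n. B $$ (i, j)) = 1"
    using assms(1) by (auto simp: row_stochastic_def)
  have fin: "finite ?I" and ne: "?I \<noteq> {}"
    using assms(2) by (auto simp: lessThan_empty_iff)
  have rel: "?d x = 2 - 2 * ?m x" if xI: "x \<in> ?I" for x
  proof -
    obtain i k where x: "x = (i, k)" "i < n" "k < n"
      using xI by auto
    have "(\<Sum>j<n. \<bar>B $$ (i, j) - B $$ (k, j)\<bar>)
        = (\<Sum>j<n. B $$ (i, j) + B $$ (k, j) - 2 * min (B $$ (i, j)) (B $$ (k, j)))"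
      by (intro sum.cong) (auto simp: min_def)
    also have "\<dots> = 2 - 2 * (\<Sum>j<n. min (B $$ (i, j)) (B $$ (k, j)))"
      using sums[OF x(2)] sums[OF x(3)]
      by (simp add: sum.distrib sum_subtractf sum_distrib_left)
    finally show ?thesis
      using x by simp
  qed
  obtain y where y: "y \<in> ?I" "?m y = Min (?m ` ?I)"
    using Min_in[of "?m ` ?I"] fin ne by fastforce
  have "(SUP x \<in> ?I. ?d x) = 2 - 2 * Min (?m ` ?I)"
  proof (rule cSup_eq_maximum)
    show "2 - 2 * Min (?m ` ?I) \<in> ?d ` ?I"
      using rel[OF y(1)] y by (metis (no_types, lifting) image_eqI)
    show "z \<le> 2 - 2 * Min (?m ` ?I)" if z: "z \<in> ?d ` ?I" for z
    proof -
      obtain x where x: "x \<in> ?I" "z = ?d x"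
        using z by blast
      have "Min (?m ` ?I) \<le> ?m x"
        using fin x(1) by (intro Min_le) auto
      then show ?thesis
        using rel[OF x(1)] x(2) by linarith
    qed
  qed
  then show ?thesis
    by (simp add: q_def dims)
qed

end

theory Submission
  imports Defs
begin

text \<open>\<open>A\<close> fixes the constant vectors, so \<open>\<lambda>\<^sub>2, \<dots>, \<lambda>\<^sub>n\<close> are the eigenvalues of the map that
  \<open>A\<close> induces on the quotient by the constants, whether or not 1 is a simple eigenvalue of \<open>A\<close>.
  An eigenvector for \<open>\<lambda>\<^sub>2\<close> in the quotient is a nonconstant \<open>f\<close> such that \<open>A f - \<lambda>\<^sub>2 f\<close> is
  constant. A row stochastic \<open>B\<close> contracts the oscillation \<open>max |f i - f k|\<close> by the factor \<open>q B\<close>;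
  evaluating \<open>A = c P + (1 - c) E\<close> at a pair of indices where the oscillation of \<open>f\<close> is attained
  gives the bound. If \<open>E\<close> has rank 1, its rows coincide, so \<open>q E = 0\<close>.\<close>

text \<open>The matrix of the induced map on the quotient by the constants, each class being
  represented by the vector whose entry at index 0 vanishes.\<close>

definition deflation :: "'a :: comm_ring_1 mat \<Rightarrow> 'a mat" where
  "deflation A = mat (dim_row A - 1) (dim_col A - 1)
     (\<lambda>(i, j). A $$ (Suc i, Suc j) - A $$ (0, Suc j))"

text \<open>In the basis formed by the constant vector 1 and the unit vectors of index at least 1,
  \<open>A\<close> is block upper triangular: the corner is \<open>s\<close>, since \<open>A\<close>
  maps 1 to \<open>s\<close> times 1, and the other diagonal block is
  \<open>deflation A\<close>.\<close>

lemma char_poly_deflation: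
  fixes A :: "'a :: comm_ring_1 mat"
  assumes A: "A \<in> carrier_mat (Suc m) (Suc m)"
    and rows: "\<And>i. i < Suc m \<Longrightarrow> (\<Sum>j<Suc m. A $$ (i, j)) = s"
  shows "char_poly A = [:- s, 1:] * char_poly (deflation A)"
proof -
  let ?n = "Suc m"
  \<comment> \<open>The columns of \<open>U 1\<close> are this basis: the identity with its first
    column replaced by ones. Its inverse \<open>U (- 1)\<close> subtracts entry 0 from all later
    entries.\<close>
  define U where "U a = mat ?n ?n (\<lambda>(i, j). if i = j then 1 else if j = 0 then a else (0 :: 'a))" for a
  define r where "r = mat 1 m (\<lambda>(i, j). A $$ (0, Suc j))"
  define C where "C = four_block_mat (mat 1 1 (\<lambda>_. s)) r (0\<^sub>m m 1) (deflation A)"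
  have defl: "deflation A \<in> carrier_mat m m"
    using A by (auto simp: deflation_def)
  have r: "r \<in> carrier_mat 1 m"
    by (simp add: r_def)
  have U: "U a \<in> carrier_mat ?n ?n" for a
    by (simp add: U_def)
  have C: "C \<in> carrier_mat ?n ?n"
    using defl by (auto simp: C_def)
  have inv: "U a * U (- a) = 1\<^sub>m ?n" for a
  proof (rule eq_matI)
    fix i j assume "i < dim_row (1\<^sub>m ?n)" "j < dim_col (1\<^sub>m ?n)"
    then show "(U a * U (- a)) $$ (i, j) = 1\<^sub>m ?n $$ (i, j)"
      by (cases i; cases j)
        (auto simp: U_def scalar_prod_def sum.atLeast0_lessThan_Suc_shift
          if_distrib[of "\<lambda>x. x * _"] if_distrib[of "\<lambda>x. _ * x"] sum_negf
          simp del: sum.op_ivl_Suc cong: if_cong)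
  qed (simp_all add: U_def)
  have comm: "U 1 * C = A * U 1"
  proof (rule eq_matI)
    fix i j assume ij: "i < dim_row (A * U 1)" "j < dim_col (A * U 1)"
    \<comment> \<open>The row sums enter through column 0 of \<open>A * U 1\<close>, which is
      constantly \<open>s\<close>.\<close>
    have s0: "(\<Sum>k = 0..<m. A $$ (i, Suc k)) = s - A $$ (i, 0)"
      using rows[of i] ij A
      by (auto simp: sum.atLeast0_lessThan_Suc_shift lessThan_atLeast0 simp del: sum.op_ivl_Suc)
    show "(U 1 * C) $$ (i, j) = (A * U 1) $$ (i, j)"
      using ij A defl s0
      by (cases i; cases j)
        (auto simp: U_def C_def r_def deflation_def scalar_prod_def sum.atLeast0_lessThan_Suc_shift
          if_distrib[of "\<lambda>x. x * _"] if_distrib[of "\<lambda>x. _ * x"] simp del: sum.op_ivl_Suc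
          cong: if_cong)
  qed (use A defl in \<open>auto simp: U_def C_def\<close>)
  have "U 1 * C * U (- 1) = A * (U 1 * U (- 1))"
    using A U by (simp add: comm assoc_mult_mat[of _ ?n ?n _ ?n _ ?n])
  then have "A = U 1 * C * U (- 1)"
    using A by (simp add: inv)
  then have "similar_mat A C"
    using A U C inv[of 1] inv[of "- 1"] by (intro similar_matI[of _ _ "U 1" "U (- 1)" ?n]) auto
  then have "char_poly A = char_poly C"
    by (rule char_poly_similar)
  also have "\<dots> = char_poly (mat 1 1 (\<lambda>_. s)) * char_poly (deflation A)"
    unfolding C_def by (rule char_poly_four_block_zeros_col) (use r defl in auto)
  also have "char_poly (mat 1 1 (\<lambda>_. s)) = [:- s, 1:]"
    by (simp add: char_poly_def char_poly_matrix_def det_single)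
  finally show ?thesis .
qed

section \<open>Balanced sums and the coefficient \<open>q\<close>\<close>

lemma norm_sum_balanced_le:
  fixes \<mu> :: "'b \<Rightarrow> real" and f :: "'b \<Rightarrow> 'a :: real_normed_vector"
  assumes "finite S" and zero: "sum \<mu> S = 0"
    and D: "\<And>j l. j \<in> S \<Longrightarrow> l \<in> S \<Longrightarrow> norm (f j - f l) \<le> D"
  shows "norm (\<Sum>j\<in>S. \<mu> j *\<^sub>R f j) \<le> (\<Sum>j\<in>S. \<bar>\<mu> j\<bar>) / 2 * D"
proof -
  \<comment> \<open>Both parts of \<open>\<mu>\<close> have mass \<open>M\<close>; the product coupling \<open>p j * r l\<close> turns \<open>M\<close> times the sum
    into a weighted sum of differences \<open>f j - f l\<close>.\<close>
  define p where "p j = max 0 (\<mu> j)" for j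
  define r where "r j = max 0 (- \<mu> j)" for j
  define M where "M = sum p S"
  have \<mu>: "\<mu> j = p j - r j" and abs: "\<bar>\<mu> j\<bar> = p j + r j" for j
    by (auto simp: p_def r_def)
  have nonneg: "0 \<le> p j" "0 \<le> r j" for j
    by (auto simp: p_def r_def)
  have Mr: "sum r S = M"
    using zero by (simp add: \<mu> sum_subtractf M_def)
  have half: "(\<Sum>j\<in>S. \<bar>\<mu> j\<bar>) / 2 = M"
    using Mr by (simp add: abs sum.distrib M_def)
  have "M \<ge> 0"
    unfolding M_def by (intro sum_nonneg nonneg)
  show ?thesis
  proof (cases "M = 0")
    case True
    then have "\<mu> j = 0" if "j \<in> S" for j
      using half \<open>finite S\<close> that by (simp add: sum_nonneg_eq_0_iff)
    then show ?thesis
      using True half by simp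
  next
    case False
    have "M *\<^sub>R (\<Sum>j\<in>S. \<mu> j *\<^sub>R f j) = (\<Sum>j\<in>S. (M * p j) *\<^sub>R f j) - (\<Sum>l\<in>S. (M * r l) *\<^sub>R f l)"
      by (simp add: \<mu> scaleR_sum_right algebra_simps sum_subtractf)
    \<comment> \<open>\<open>M\<close> is read as the mass of \<open>r\<close> in the first sum and
      as the mass of \<open>p\<close> in the second, so both become double sums with the same
      weights.\<close>
    also have "\<dots> = (\<Sum>j\<in>S. \<Sum>l\<in>S. (p j * r l) *\<^sub>R f j) - (\<Sum>l\<in>S. \<Sum>j\<in>S. (p j * r l) *\<^sub>R f l)"
      by (simp add: scaleR_sum_left[symmetric] sum_distrib_left[symmetric] sum_distrib_right[symmetric]
          Mr M_def[symmetric] mult.commute)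
    also have "\<dots> = (\<Sum>j\<in>S. \<Sum>l\<in>S. (p j * r l) *\<^sub>R (f j - f l))"
      by (subst (2) sum.swap) (simp add: scaleR_diff_right sum_subtractf)
    finally have "M * norm (\<Sum>j\<in>S. \<mu> j *\<^sub>R f j) = norm (\<Sum>j\<in>S. \<Sum>l\<in>S. (p j * r l) *\<^sub>R (f j - f l))"
      using \<open>M \<ge> 0\<close> by (metis abs_of_nonneg norm_scaleR)
    also have "\<dots> \<le> (\<Sum>j\<in>S. \<Sum>l\<in>S. p j * r l * D)"
      using D nonneg by (intro sum_norm_le) (auto intro!: mult_left_mono)
    also have "\<dots> = M * (M * D)"
      by (simp add: sum_distrib_left[symmetric] sum_distrib_right[symmetric] Mr M_def[symmetric]
          mult.assoc)
    finally show ?thesis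
      using False \<open>M \<ge> 0\<close> by (simp add: half)
  qed
qed

lemma row_diff_le_q:
  assumes "row_stochastic n B" and "i < n" and "k < n"
  shows "(\<Sum>j<n. \<bar>B $$ (i, j) - B $$ (k, j)\<bar>) / 2 \<le> q B"
proof -
  let ?d = "\<lambda>(i, k). \<Sum>j<n. \<bar>B $$ (i, j) - B $$ (k, j)\<bar>"
  have "dim_row B = n" "dim_col B = n"
    using assms(1) by (auto simp: row_stochastic_def)
  moreover have "?d (i, k) \<le> (SUP x \<in> {..<n} \<times> {..<n}. ?d x)"
    using assms by (intro cSUP_upper bdd_above_finite) auto
  ultimately show ?thesis
    by (simp add: q_def)
qed

lemma q_le_1:
  assumes "row_stochastic n B" and "n \<ge> 1"
  shows "q B \<le> 1"
proof -
  have "0 \<le> (\<Sum>j<n. min (B $$ (i, j)) (B $$ (k, j)))" if "i < n" "k < n" for i k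
    using assms that by (intro sum_nonneg) (auto simp: row_stochastic_def)
  then have "0 \<le> Min ((\<lambda>(i, k). \<Sum>j<n. min (B $$ (i, j)) (B $$ (k, j))) ` ({..<n} \<times> {..<n}))"
    using assms(2) by (subst Min_ge_iff) (auto simp: lessThan_empty_iff)
  then show ?thesis
    by (simp add: q_eq_one_minus_Min[OF assms])
qed

section \<open>Stochastic matrices of rank 1\<close>

text \<open>Otherwise the two columns would be linearly independent and force rank at least
  2.\<close>

lemma (in vec_space) rank_le_1_cols_proportional:
  assumes A: "A \<in> carrier_mat n nc" and "rank A \<le> 1"
    and j: "j < nc" and u: "col A j \<noteq> 0\<^sub>v n" and l: "l < nc"
  shows "\<exists>a. col A l = a \<cdot>\<^sub>v col A j"
proof (rule ccontr)
  assume no: "\<nexists>a. col A l = a \<cdot>\<^sub>v col A j"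
  let ?u = "col A j" and ?v = "col A l"
  have uv: "?u \<in> carrier_vec n" "?v \<in> carrier_vec n"
    using A by (auto simp: carrier_matD)
  have sub: "{?u, ?v} \<subseteq> set (cols A)"
    using A j l by (auto simp: cols_def)
  have "?u \<noteq> ?v"
    using no by (metis one_smult_vec)
  have "?v \<notin> span {?u}"
  proof
    assume "?v \<in> span {?u}"
    then obtain a where "lincomb a {?u} = ?v"
      using finite_in_span[of "{?u}" ?v] uv by auto
    then have "?v = a ?u \<cdot>\<^sub>v ?u"
      using uv lincomb_insert2[of "{}" a ?u] by (auto simp: lincomb_empty)
    then show False
      using no by blast
  qed
  moreover have "lin_indpt {?u}"
    using lin_dep_iff_in_span[of "{}" ?u] u uv finite_lin_indpt2[of "{}"] by (auto simp: span_empty)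
  ultimately have "lin_indpt {?u, ?v}"
    using lin_dep_iff_in_span[of "{?u}" ?v] uv \<open>?u \<noteq> ?v\<close> by (auto simp: insert_commute)
  then have "2 \<le> rank A"
    using rank_ge_card_indpt[OF A sub] \<open>?u \<noteq> ?v\<close> by simp
  then show False
    using assms(2) by simp
qed

text \<open>All columns are multiples of one nonzero column, so all rows are multiples of one
  vector; having the same sum 1, they coincide.\<close>

lemma row_stochastic_rank_1_rows_eq:
  assumes E: "row_stochastic n E" and rank: "vec_space.rank n E = 1"
    and i: "i < n" and k: "k < n" and "j < n"
  shows "E $$ (i, j) = E $$ (k, j)"
proof -
  have car: "E \<in> carrier_mat n n" and sums: "\<And>h. h < n \<Longrightarrow> (\<Sum>j<n. E $$ (h, j)) = 1"
    using E by (auto simp: row_stochastic_def)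
  obtain l where l: "l < n" "E $$ (i, l) \<noteq> 0"
    using sums[OF i] by (metis lessThan_iff sum.neutral zero_neq_one)
  have "col E l $ i \<noteq> 0"
    using l i car by simp
  then have "col E l \<noteq> 0\<^sub>v n"
    using i by (metis index_zero_vec(1))
  then have "\<forall>h<n. \<exists>a. col E h = a \<cdot>\<^sub>v col E l"
    using vec_space.rank_le_1_cols_proportional[OF car] rank l by auto
  then obtain a where a: "\<And>h. h < n \<Longrightarrow> col E h = a h \<cdot>\<^sub>v col E l"
    by metis
  have entry: "E $$ (h, m) = a m * E $$ (h, l)" if "h < n" "m < n" for h m
    using arg_cong[OF a[OF that(2)], of "\<lambda>v. v $ h"] that l car by simp
  \<comment> \<open>The first factor does not depend on the row \<open>h\<close>, hence neither does
    \<open>E $$ (h, l)\<close>.\<close>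
  have "(\<Sum>m<n. a m) * E $$ (h, l) = 1" if "h < n" for h
    using sums[OF that] entry[OF that] by (simp add: sum_distrib_right)
  then have "E $$ (i, l) = E $$ (k, l)"
    using i k by (metis mult_cancel_left mult_zero_left zero_neq_one)
  then show ?thesis
    using entry assms by simp
qed

lemma q_rank_1:
  assumes "row_stochastic n E" and "vec_space.rank n E = 1" and "n \<ge> 1"
  shows "q E = 0"
proof -
  have dims: "dim_row E = n" "dim_col E = n"
    using assms(1) by (auto simp: row_stochastic_def)
  have "(SUP (i, k) \<in> {..<n} \<times> {..<n}. \<Sum>j<n. \<bar>E $$ (i, j) - E $$ (k, j)\<bar>)
      = (SUP x \<in> {..<n} \<times> {..<n}. 0)"
    by (rule SUP_cong) (auto intro!: sum.neutral row_stochastic_rank_1_rows_eq[OF assms(1,2)])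
  also have "\<dots> = 0"
    using assms(3) by (simp add: lessThan_empty_iff)
  finally show ?thesis
    by (simp add: q_def dims)
qed

section \<open>The second eigenvalue on the quotient\<close>

text \<open>The equation says that \<open>A f - \<mu> f\<close> is constant, written with row
  differences because these are what \<open>q\<close> controls.\<close>

lemma deflation_eigenvector_differences:
  fixes A :: "'a :: comm_ring_1 mat"
  assumes A: "A \<in> carrier_mat (Suc m) (Suc m)" and ev: "eigenvalue (deflation A) \<mu>"
  obtains f where "\<exists>i<Suc m. f i \<noteq> f 0"
    and "\<And>i k. i < Suc m \<Longrightarrow> k < Suc m \<Longrightarrow>
      (\<Sum>j<Suc m. (A $$ (i, j) - A $$ (k, j)) * f j) = \<mu> * (f i - f k)"
proof -
  have dim: "dim_row (deflation A) = m" "dim_col (deflation A) = m"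
    using A by (auto simp: deflation_def)
  obtain w where w: "w \<in> carrier_vec m" "w \<noteq> 0\<^sub>v m" and eq: "deflation A *\<^sub>v w = \<mu> \<cdot>\<^sub>v w"
    using ev by (auto simp: eigenvalue_def eigenvector_def dim)
  define f where "f i = (case i of 0 \<Rightarrow> 0 | Suc i \<Rightarrow> w $ i)" for i
  have f: "f 0 = 0" "f (Suc i) = w $ i" for i
    by (auto simp: f_def)
  \<comment> \<open>The term \<open>j = 0\<close> vanishes because \<open>f 0 = 0\<close>; the
    remaining terms form a row of \<open>deflation A\<close>.\<close>
  have base: "(\<Sum>j<Suc m. (A $$ (i, j) - A $$ (0, j)) * f j) = \<mu> * f i" if i: "i < Suc m" for i
  proof (cases i)
    case (Suc h)
    then have "(deflation A *\<^sub>v w) $ h = \<mu> * w $ h"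
      using i w by (simp add: eq)
    then show ?thesis
      using Suc i w A
      by (simp add: f sum.atLeast0_lessThan_Suc_shift scalar_prod_def deflation_def lessThan_atLeast0
          del: sum.op_ivl_Suc)
  qed (simp add: f)
  obtain h where "h < m" "w $ h \<noteq> 0"
    using w by (metis eq_vecI carrier_vecD index_zero_vec)
  show thesis
  proof (rule that)
    show "\<exists>i<Suc m. f i \<noteq> f 0"
      using \<open>h < m\<close> \<open>w $ h \<noteq> 0\<close> f by (intro exI[of _ "Suc h"]) auto
    show "(\<Sum>j<Suc m. (A $$ (i, j) - A $$ (k, j)) * f j) = \<mu> * (f i - f k)"
      if "i < Suc m" "k < Suc m" for i k
      using base[OF that(1)] base[OF that(2)]
      by (simp add: algebra_simps sum_subtractf del: sum.lessThan_Suc)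
  qed
qed

text \<open>Cancelling one factor \<open>[:- 1, 1:]\<close>, which the constants contribute on one
  side and \<open>lam 1\<close> on the other, leaves \<open>lam 2\<close> as a root, even if 1 is a
  multiple eigenvalue.\<close>

lemma ordered_eigenvalues_second:
  fixes A :: "real mat"
  assumes A: "A \<in> carrier_mat n n" and "n \<ge> 2"
    and rows: "\<And>i. i < n \<Longrightarrow> (\<Sum>j<n. A $$ (i, j)) = 1"
    and ord: "ordered_eigenvalues n A lam"
  shows "eigenvalue (deflation (map_mat complex_of_real A)) (lam 2)"
proof -
  obtain m where n: "n = Suc m"
    using \<open>n \<ge> 2\<close> by (cases n) auto
  let ?A = "map_mat complex_of_real A"
  have A': "?A \<in> carrier_mat (Suc m) (Suc m)"
    using A n by simp
  have defl: "deflation ?A \<in> carrier_mat m m"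
    using A' by (auto simp: deflation_def)
  have "(\<Sum>j<Suc m. ?A $$ (i, j)) = 1" if "i < Suc m" for i
    using arg_cong[OF rows[of i], of complex_of_real] A that n by (simp del: sum.lessThan_Suc)
  then have "[:- 1, 1:] * char_poly (deflation ?A) = char_poly ?A"
    using char_poly_deflation[OF A', of 1] by simp
  also have "\<dots> = [:- lam 1, 1:] * (\<Prod>k=2..n. [:- lam k, 1:])"
    using ord \<open>n \<ge> 2\<close> by (simp add: ordered_eigenvalues_def prod.atLeast_Suc_atMost numeral_2_eq_2)
  also have "lam 1 = 1"
    using ord by (simp add: ordered_eigenvalues_def)
  finally have "char_poly (deflation ?A) = (\<Prod>k=2..n. [:- lam k, 1:])"
    by (subst (asm) mult_cancel_left) auto
  then have "poly (char_poly (deflation ?A)) (lam 2) = 0"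
    using \<open>n \<ge> 2\<close> by (auto simp: poly_prod intro!: prod_zero bexI[of _ 2])
  then show ?thesis
    by (simp add: eigenvalue_root_char_poly[OF defl])
qed

section \<open>Contraction and the final estimate\<close>

text \<open>Both rows sum to 1, so their difference has total mass 0 and the bound for balanced sums
  applies.\<close>

lemma norm_row_difference_le:
  fixes f :: "nat \<Rightarrow> 'a :: real_normed_vector"
  assumes B: "row_stochastic n B" and i: "i < n" and k: "k < n"
    and D: "\<And>j l. j < n \<Longrightarrow> l < n \<Longrightarrow> norm (f j - f l) \<le> D"
  shows "norm (\<Sum>j<n. (B $$ (i, j) - B $$ (k, j)) *\<^sub>R f j) \<le> q B * D"
proof -
  have "0 \<le> D"
    using D[OF i i] by simp
  have "norm (\<Sum>j<n. (B $$ (i, j) - B $$ (k, j)) *\<^sub>R f j)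
      \<le> (\<Sum>j<n. \<bar>B $$ (i, j) - B $$ (k, j)\<bar>) / 2 * D"
    using B i k D by (intro norm_sum_balanced_le) (auto simp: row_stochastic_def sum_subtractf)
  also have "\<dots> \<le> q B * D"
    using row_diff_le_q[OF B i k] \<open>0 \<le> D\<close> by (rule mult_right_mono)
  finally show ?thesis .
qed

theorem corollary1:
  fixes n :: nat and P E A :: "real mat" and c :: real and lam :: "nat \<Rightarrow> complex"
  assumes "n \<ge> 2"
    and "row_stochastic n P" and "row_stochastic n E"
    and "0 \<le> c" and "c \<le> 1"
    and "A = c \<cdot>\<^sub>m P + (1 - c) \<cdot>\<^sub>m E"
    and "ordered_eigenvalues n A lam"
  shows "cmod (lam 2) \<le> c * q P + (1 - c) * q E
       \<and> (vec_space.rank n E = 1 \<longrightarrow> cmod (lam 2) \<le> c)"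
proof -
  obtain m where n: "n = Suc m"
    using assms(1) by (cases n) auto
  have P: "P \<in> carrier_mat n n" and E: "E \<in> carrier_mat n n"
    using assms(2,3) by (auto simp: row_stochastic_def)
  then have A: "A \<in> carrier_mat n n"
    by (auto simp: assms(6))
  have entry: "A $$ (i, j) = c * P $$ (i, j) + (1 - c) * E $$ (i, j)" if "i < n" "j < n" for i j
    using P E that by (simp add: assms(6))
  have "(\<Sum>j<n. A $$ (i, j)) = 1" if "i < n" for i
    using assms(2,3) that
    by (simp add: entry sum.distrib sum_distrib_left[symmetric] row_stochastic_def)
  then have "eigenvalue (deflation (map_mat complex_of_real A)) (lam 2)"
    using A assms(1,7) by (intro ordered_eigenvalues_second)
  then obtain f where nonconst: "\<exists>i<n. f i \<noteq> f 0"
    and f: "\<And>i k. i < n \<Longrightarrow> k < n \<Longrightarrow>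
      (\<Sum>j<n. (map_mat complex_of_real A $$ (i, j) - map_mat complex_of_real A $$ (k, j)) * f j)
        = lam 2 * (f i - f k)"
    using deflation_eigenvector_differences[of "map_mat complex_of_real A" m "lam 2"] A
    unfolding n by auto
  define D where "D = Max ((\<lambda>(i, k). cmod (f i - f k)) ` ({..<n} \<times> {..<n}))"
  have le_D: "cmod (f i - f k) \<le> D" if "i < n" "k < n" for i k
    unfolding D_def using that by (intro Max_ge) (auto intro!: image_eqI[of _ _ "(i, k)"])
  have "D \<in> (\<lambda>(i, k). cmod (f i - f k)) ` ({..<n} \<times> {..<n})"
    unfolding D_def using n by (intro Max_in) auto
  \<comment> \<open>At a pair attaining the oscillation \<open>D\<close>, the modulus of
    \<open>lam 2 * (f i - f k)\<close> is exactly \<open>cmod (lam 2) * D\<close>;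
    \<open>D > 0\<close> then allows cancelling \<open>D\<close>.\<close>
  then obtain i k where ik: "i < n" "k < n" "D = cmod (f i - f k)"
    by auto
  obtain h where "h < n" "f h \<noteq> f 0"
    using nonconst by blast
  then have "D > 0"
    using le_D[of h 0] n by (intro less_le_trans[of 0 "cmod (f h - f 0)" D]) auto
  have "lam 2 * (f i - f k) = (\<Sum>j<n. (A $$ (i, j) - A $$ (k, j)) *\<^sub>R f j)"
    unfolding f[OF ik(1,2), symmetric] using A ik
    by (intro sum.cong refl) (simp add: scaleR_conv_of_real)
  also have "\<dots> = c *\<^sub>R (\<Sum>j<n. (P $$ (i, j) - P $$ (k, j)) *\<^sub>R f j)
      + (1 - c) *\<^sub>R (\<Sum>j<n. (E $$ (i, j) - E $$ (k, j)) *\<^sub>R f j)"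
    unfolding scaleR_sum_right sum.distrib[symmetric] using ik
    by (intro sum.cong refl) (simp add: entry scaleR_conv_of_real algebra_simps)
  finally have "cmod (lam 2) * D = cmod (c *\<^sub>R (\<Sum>j<n. (P $$ (i, j) - P $$ (k, j)) *\<^sub>R f j)
      + (1 - c) *\<^sub>R (\<Sum>j<n. (E $$ (i, j) - E $$ (k, j)) *\<^sub>R f j))"
    by (metis ik(3) norm_mult)
  also have "\<dots> \<le> c * (q P * D) + (1 - c) * (q E * D)"
    using assms(4,5) ik le_D
    by (intro norm_triangle_le add_mono)
      (auto intro!: mult_left_mono norm_row_difference_le assms(2,3))
  finally have "cmod (lam 2) * D \<le> (c * q P + (1 - c) * q E) * D"
    by (simp add: algebra_simps)
  then have le: "cmod (lam 2) \<le> c * q P + (1 - c) * q E"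
    using \<open>D > 0\<close> by simp
  \<comment> \<open>Here \<open>q E = 0\<close> and \<open>q P \<le> 1\<close>.\<close>
  have "c * q P + (1 - c) * q E \<le> c" if "vec_space.rank n E = 1"
    using q_rank_1[OF assms(3) that] q_le_1[OF assms(2)] assms(1,4) by (simp add: mult_left_le)
  then show ?thesis
    using le by auto
qed

end
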